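(* Let $(\mathcal{X},d)$ be a metric space, let $f,g:\mathcal{X}\to\mathcal{X}$ be maps and $F,G:\mathcal{X}\to\mathcal{P}_{fb}(\mathcal{X})$ be set-valued maps such that the pairs $\{f,F\}$ and $\{g,G\}$ are occasionally weakly compatible. Let $\Psi:\mathbb{R}^+\to\mathbb{R}^+$ be a nondecreasing map such that $\Psi(t)<t$ for every $t>0$, and let $0<a\le 1$ and $p\ge 1$. Suppose that for all $x,y\in\mathcal{X}$, $$\delta^{p}(Fx,Gy)\le \Psi\big[a\,d^{p}(fx,gy)+(1-a)\,d^{\frac p2}(gy,Fx)\,d^{\frac p2}(fx,Gy)\big].$$ Then $f$, $g$, $F$ and $G$ have a unique common fixed point.
   Context: $\mathcal{P}_{fb}(\mathcal{X})$ is the class of all nonempty bounded closed subsets of $\mathcal{X}$. $\mathbb{R}^+=[0,\infty)$. We write $fx=f(x)$, $Fx=F(x)$, and for $x\in\mathcal{X}$, $A,B\subseteq\mathcal{X}$, $d(x,A)=\inf\{d(x,y):y\in A\}$ and $\delta(A,B)=\sup\{d(a,b):a\in A,\,b\in B\}$; $d^p(\cdot,\cdot)$ and $\delta^p(\cdot,\cdot)$ denote $p$-th powers. A pair $\{f,F\}$ with $f:\mathcal{X}\to\mathcal{X}$ and $F:\mathcal{X}\to\mathcal{P}_{fb}(\mathcal{X})$ is occasionally weakly compatible (owc) if there exists $x\in\mathcal{X}$ such that $fx\in Fx$ and $fFx\subseteq Ffx$, where $fFx=\{f(y):y\in F(x)\}$ and $Ffx=F(f(x))$. A common fixed point of $f,g,F,G$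 is a point $w\in\mathcal{X}$ with $w=fw=gw$, $w\in Fw$ and $w\in Gw$. *)

theory Defs
  imports "HOL-Analysis.Analysis"
begin

definition P_fb :: "'a::metric_space set set" where
  "P_fb = {A. A \<noteq> {} \<and> bounded A \<and> closed A}"

text \<open>The supremum is taken in the reals, so it is meaningful only for nonempty bounded
  \<^term>\<open>A\<close> and \<^term>\<open>B\<close>, in particular for members of \<^const>\<open>P_fb\<close>.
  The distance from a point to a nonempty set is \<^const>\<open>infdist\<close>.\<close>

definition delta :: "'a::metric_space set \<Rightarrow> 'a set \<Rightarrow> real" where
  "delta A B = (SUP (a, b)\<in>A \<times> B. dist a b)"

definition owc :: "('a \<Rightarrow> 'a) \<Rightarrow> ('a \<Rightarrow> 'a set) \<Rightarrow> bool" where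
  "owc f F \<longleftrightarrow> (\<exists>x. f x \<in> F x \<and> f ` F x \<subseteq> F (f x))"

definition common_fixed_point ::
  "('a \<Rightarrow> 'a) \<Rightarrow> ('a \<Rightarrow> 'a) \<Rightarrow> ('a \<Rightarrow> 'a set) \<Rightarrow> ('a \<Rightarrow> 'a set) \<Rightarrow> 'a \<Rightarrow> bool" where
  "common_fixed_point f g F G w \<longleftrightarrow> w = f w \<and> w = g w \<and> w \<in> F w \<and> w \<in> G w"

end

(* The contraction forces f u = g v whenever f u lies in F u and g v lies in G v: with
   D = d(f u, g v), both point-to-set distances are at most D and delta(F u, G v) is at least D,
   so D^p <= Psi(D^p), which is only possible for D = 0.  Weak compatibility at x turns f x into
   a second point of coincidence of f and F, and likewise g y for g and G; comparing the four
   points gives f x = g y = f (f x) = g (g y).  The same fact gives uniqueness. *)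

theory Submission
  imports Defs
begin

text \<open>A real supremum dominates its members only when they are bounded above; here a bound
  comes from the finite diameter of \<open>A \<times> B\<close>.\<close>

lemma dist_le_delta:
  assumes A: "bounded A" and B: "bounded B" and ab: "a \<in> A" "b \<in> B"
  shows "dist a b \<le> delta A B"
proof -
  have "bounded (A \<times> B)" using A B by (rule bounded_Times)
  then obtain e where e: "\<And>y z. y \<in> A \<times> B \<Longrightarrow> z \<in> A \<times> B \<Longrightarrow> dist y z \<le> e"
    unfolding bounded_two_points by blast
  \<comment> \<open>Travel from \<open>y\<close> to \<open>z\<close> through \<open>a\<close> and
    \<open>b\<close>: the product metric dominates each coordinate distance, so both outer legs cost
    at most \<open>e\<close>.\<close>
  have bound: "dist y z \<le> dist a b + e + e" if "y \<in> A" "z \<in> B" for y z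
  proof -
    have "dist (y, z) (a, b) \<le> e" using e that ab by simp
    moreover have "dist y a \<le> dist (y, z) (a, b)"
      using dist_fst_le[of "(y, z)" "(a, b)"] by simp
    moreover have "dist z b \<le> dist (y, z) (a, b)"
      using dist_snd_le[of "(y, z)" "(a, b)"] by simp
    moreover have "dist y z \<le> dist y a + dist a b + dist z b"
      using dist_triangle[of y z a] dist_triangle[of a z b] by (simp add: dist_commute)
    ultimately show ?thesis by linarith
  qed
  have "bdd_above ((\<lambda>(a, b). dist a b) ` (A \<times> B))"
    by (rule bdd_aboveI[where M = "dist a b + e + e"]) (use bound in auto)
  from cSUP_upper[OF _ this, of "(a, b)"] ab show ?thesis
    unfolding delta_def by simp
qed

lemma coincidence_values_eq:
  fixes f g :: "'a::metric_space \<Rightarrow> 'a" and \<Psi> :: "real \<Rightarrow> real"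
  assumes bounded: "bounded (F u)" "bounded (G v)"
    and Psi_mono: "mono_on {0..} \<Psi>"
    and Psi_less: "\<And>t. 0 < t \<Longrightarrow> \<Psi> t < t"
    and a: "0 \<le> a" "a \<le> 1"
    and p: "0 \<le> p"
    and contr: "delta (F u) (G v) powr p
      \<le> \<Psi> (a * dist (f u) (g v) powr p
            + (1 - a) * (infdist (g v) (F u) powr (p / 2) * infdist (f u) (G v) powr (p / 2)))"
    and u: "f u \<in> F u" and v: "g v \<in> G v"
  shows "f u = g v"
proof (rule ccontr)
  assume "f u \<noteq> g v"
  define D where "D = dist (f u) (g v)"
  have D: "0 < D" using \<open>f u \<noteq> g v\<close> by (simp add: D_def)
  let ?P = "infdist (g v) (F u) powr (p / 2) * infdist (f u) (G v) powr (p / 2)"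
  have "infdist (g v) (F u) \<le> D" "infdist (f u) (G v) \<le> D"
    using infdist_le[OF u, of "g v"] infdist_le[OF v, of "f u"]
    by (simp_all add: D_def dist_commute)
  \<comment> \<open>The two half powers recombine to \<open>D powr p\<close>, so the argument of
    \<open>\<Psi>\<close> is at most a convex combination of \<open>D powr p\<close> with
    itself.\<close>
  then have "?P \<le> D powr (p / 2) * D powr (p / 2)"
    using p by (intro mult_mono powr_mono2) (auto simp: infdist_nonneg)
  also have "\<dots> = D powr p" by (simp flip: powr_add)
  finally have "(1 - a) * ?P \<le> (1 - a) * D powr p"
    using a by (intro mult_left_mono) auto
  then have le: "a * D powr p + (1 - a) * ?P \<le> D powr p" by (simp add: algebra_simps)
  have "D powr p \<le> delta (F u) (G v) powr p"
    unfolding D_def using p bounded u v by (intro powr_mono2 dist_le_delta) auto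
  also have "\<dots> \<le> \<Psi> (a * D powr p + (1 - a) * ?P)" using contr by (simp add: D_def)
  also have "\<dots> \<le> \<Psi> (D powr p)"
    using a le by (intro mono_onD[OF Psi_mono]) auto
  also have "\<dots> < D powr p" using D by (intro Psi_less) simp
  finally show False by simp
qed

theorem theorem3p1:
  fixes f g :: "'a::metric_space \<Rightarrow> 'a"
    and F G :: "'a \<Rightarrow> 'a set"
    and \<Psi> :: "real \<Rightarrow> real"
    and a p :: real
  assumes F_fb: "\<And>x. F x \<in> P_fb"
    and G_fb: "\<And>x. G x \<in> P_fb"
    and owc_fF: "owc f F"
    and owc_gG: "owc g G"
    and Psi_nonneg: "\<And>t. 0 \<le> t \<Longrightarrow> 0 \<le> \<Psi> t"
    and Psi_mono: "mono_on {0..} \<Psi>"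
    and Psi_less: "\<And>t. 0 < t \<Longrightarrow> \<Psi> t < t"
    and a_pos: "0 < a"
    and a_le: "a \<le> 1"
    and p_ge: "1 \<le> p"
    and contr: "\<And>x y. delta (F x) (G y) powr p
      \<le> \<Psi> (a * dist (f x) (g y) powr p
            + (1 - a) * (infdist (g y) (F x) powr (p / 2) * infdist (f x) (G y) powr (p / 2)))"
  shows "\<exists>!w. common_fixed_point f g F G w"
proof -
  have eq: "f u = g v" if "f u \<in> F u" "g v \<in> G v" for u v
  proof -
    have "bounded (F u)" "bounded (G v)" using F_fb G_fb by (auto simp: P_fb_def)
    moreover have "0 \<le> a" "0 \<le> p" using a_pos p_ge by auto
    ultimately show ?thesis
      using coincidence_values_eq[where F = F and G = G and f = f and g = g and u = u and v = v,
          OF _ _ Psi_mono Psi_less _ a_le _ contr that] by blast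
  qed
  obtain x where x: "f x \<in> F x" "f (f x) \<in> F (f x)"
    using owc_fF unfolding owc_def by blast
  obtain y where y: "g y \<in> G y" "g (g y) \<in> G (g y)"
    using owc_gG unfolding owc_def by blast
  \<comment> \<open>These are \<open>eq\<close> at the pairs \<open>(x, y)\<close>,
    \<open>(f x, y)\<close> and \<open>(x, g y)\<close>. So \<open>f x\<close> is fixed by
    \<open>f\<close> and, being equal to \<open>g y\<close>, also by \<open>g\<close>; the
    memberships in \<open>x\<close> and \<open>y\<close> then place it in \<open>F (f x)\<close> and
    \<open>G (f x)\<close>.\<close>
  have "f x = g y" "f (f x) = g y" "f x = g (g y)"
    using eq x y by blast+
  then have "common_fixed_point f g F G (f x)"
    using x y unfolding common_fixed_point_def by metis
  \<comment> \<open>At common fixed points \<open>f w = w\<close> and \<open>g w' = w'\<close>, so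
    \<open>eq\<close> compares the points themselves.\<close>
  moreover have "w = w'"
    if "common_fixed_point f g F G w" "common_fixed_point f g F G w'" for w w'
    using eq[of w w'] that unfolding common_fixed_point_def by metis
  ultimately show ?thesis by blast
qed

end
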